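(* Let $\mathcal{G}$ be a hereditary class of graphs that has balanced separators of order $n\mapsto n^\alpha$ for some $\alpha<1$. There is some positive constant $C$ such that, if $G$ is a graph in $\mathcal{G}$, and $D$ and $D'$ are two dominating sets in $G$, then $$\partial\gamma_G(D,D')\leq C\, n(G)^\alpha.$$
   Context: All graphs are finite, simple and undirected; $n(G)$ denotes the number of vertices of $G$. A class of graphs is hereditary if it is closed under taking induced subgraphs. A graph $G$ has a balanced separator of order $k$ if there is a partition of $V(G)$ into three sets $S$, $A$, $B$ with $|S|\leq k$, $|A|,|B|\leq 2n(G)/3$, and no edge of $G$ between $A$ and $B$. A hereditary class $\mathcal{G}$ has balanced separators of order $n\mapsto n^\alpha$ if there is a positive constant $c$ such that every graph $G\in\mathcal{G}$ has a balanced separator of order $c\,n(G)^\alpha$. A set $D\subseteq V(G)$ is a dominating set if every vertex of $G$ belongs to $D$ or has a neighbor in $D$. Two dominating sets $D,D'$ are adjacent if $|D\setminus D'|+|D'\setminus D|=1$. For a positive integer $k$, $D$ $k$-transforms to $D'$ if there is a sequence $D_0,\ldots,D_\ell$ of dominating sets in $G$ with $D_0=D$, $D_\ell=D'$, $|D_i|\leq k$ for all $i$, and $D_{i-1}$ adjacent to $D_i$ for all $i\in\{1,\ldots,\ell\}$. For dominating sets $D,D'$, $\partial\gamma_G(D,D')=k-\max\{|D|,|D'|\}$, where $k$ is the smallest positive integer such that $D$ $k$-transforms to $D'$.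
   Formalization: The exponent is assumed to satisfy 0 < α < 1 (the claim fails for α ≤ 0, e.g. for perfect matchings if α < 0 and some bounded-treewidth graphs if α = 0), and the bound is claimed only for graphs G with at least one vertex (for the null graph the gap is 1). *)

theory Defs
  imports Complex_Main "Graph_Theory.Pair_Digraph" "Graph_Theory.Digraph_Component"
begin

text \<open>A finite simple undirected graph is a \<open>pair_graph\<close>: finite, loopless, with a symmetric arc
  relation. The map \<open>with_proj\<close> (also inserted as a coercion) turns it into a \<open>pre_digraph\<close>, so
  that \<open>induced_subgraph\<close> and adjacency \<open>u \<rightarrow>\<^bsub>G\<^esub> v\<close> apply. A class of graphs is a set of such
  graphs over some vertex type; it need not be closed under isomorphism.\<close>

definition hereditary :: "'a pair_pre_digraph set \<Rightarrow> bool" where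
  "hereditary \<G> \<longleftrightarrow> (\<forall>G\<in>\<G>. \<forall>H. induced_subgraph (with_proj H) (with_proj G) \<longrightarrow> H \<in> \<G>)"

text \<open>The parts \<open>S\<close>, \<open>A\<close>, \<open>B\<close> may be empty. As arcs are symmetric, excluding arcs from \<open>A\<close> to \<open>B\<close>
  excludes all edges between them.\<close>

definition has_balanced_separator :: "'a pair_pre_digraph \<Rightarrow> real \<Rightarrow> bool" where
  "has_balanced_separator G k \<longleftrightarrow>
     (\<exists>S A B. S \<union> A \<union> B = pverts G \<and> S \<inter> A = {} \<and> S \<inter> B = {} \<and> A \<inter> B = {} \<and>
        real (card S) \<le> k \<and>
        real (card A) \<le> 2 * real (card (pverts G)) / 3 \<and>
        real (card B) \<le> 2 * real (card (pverts G)) / 3 \<and>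
        (\<forall>a\<in>A. \<forall>b\<in>B. \<not> a \<rightarrow>\<^bsub>G\<^esub> b))"

definition class_has_balanced_separators ::
    "'a pair_pre_digraph set \<Rightarrow> (nat \<Rightarrow> real) \<Rightarrow> bool" where
  "class_has_balanced_separators \<G> f \<longleftrightarrow>
     (\<exists>c>0. \<forall>G\<in>\<G>. has_balanced_separator G (c * f (card (pverts G))))"

definition dominating_set :: "'a pair_pre_digraph \<Rightarrow> 'a set \<Rightarrow> bool" where
  "dominating_set G D \<longleftrightarrow>
     D \<subseteq> pverts G \<and> (\<forall>v\<in>pverts G. v \<in> D \<or> (\<exists>u\<in>D. v \<rightarrow>\<^bsub>G\<^esub> u))"

definition adjacent_sets :: "'a set \<Rightarrow> 'a set \<Rightarrow> bool" where
  "adjacent_sets D D' \<longleftrightarrow> card (D - D') + card (D' - D) = 1"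

definition transforms :: "'a pair_pre_digraph \<Rightarrow> nat \<Rightarrow> 'a set \<Rightarrow> 'a set \<Rightarrow> bool" where
  "transforms G k D D' \<longleftrightarrow>
     (\<exists>(l::nat) \<D>. \<D> 0 = D \<and> \<D> l = D' \<and>
        (\<forall>i\<le>l. dominating_set G (\<D> i) \<and> card (\<D> i) \<le> k) \<and>
        (\<forall>i\<in>{1..l}. adjacent_sets (\<D> (i - 1)) (\<D> i)))"

text \<open>Meaningful for dominating sets \<open>D\<close>, \<open>D'\<close> of a finite graph, where the minimum is attained:
  a transformation through the whole vertex set always exists.\<close>

definition dom_gap :: "'a pair_pre_digraph \<Rightarrow> 'a set \<Rightarrow> 'a set \<Rightarrow> int" where
  "dom_gap G D D' =
     int (LEAST k. k > 0 \<and> transforms G k D D') - int (max (card D) (card D'))"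

end

theory Submission
  imports Defs
begin

text \<open>Add a balanced separator \<open>S\<close> to \<open>D\<close>, exchange \<open>D \<inter> A\<close> for \<open>D' \<inter> A\<close>, then \<open>D \<inter> B\<close> for
  \<open>D' \<inter> B\<close>, and finally remove \<open>S - D'\<close>. While \<open>S\<close> is present, the vertices of \<open>A\<close> that still need to
  be dominated have no neighbour outside \<open>A\<close>, so the two exchanges are instances of the same problem
  on induced subgraphs with at most \<open>2n/3\<close> vertices, provided that only a given set \<open>T\<close> of vertices is
  required to be dominated. One of the two orders (\<open>A\<close> or \<open>B\<close> first) keeps the intermediate set
  without \<open>S\<close> no larger than \<open>max |D| |D'|\<close>, since the two intermediate sets together have at most
  \<open>|D| + |D'|\<close> elements. The exchanges are not nested, so the excess costs add up to the geometric
  series \<open>c n\<^sup>\<alpha> (1 + (2/3)\<^sup>\<alpha> + \<dots>)\<close>.\<close>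

definition dominates_on :: "('a \<times> 'a) set \<Rightarrow> 'a set \<Rightarrow> 'a set \<Rightarrow> bool" where
  "dominates_on E D T \<longleftrightarrow> (\<forall>v\<in>T. v \<in> D \<or> (\<exists>u\<in>D. (v, u) \<in> E))"

lemma dominates_on_mono: "dominates_on E D T \<Longrightarrow> D \<subseteq> D' \<Longrightarrow> dominates_on E D' T"
  unfolding dominates_on_def by blast

lemma dominating_set_iff: "dominating_set G D \<longleftrightarrow> D \<subseteq> pverts G \<and> dominates_on (parcs G) D (pverts G)"
  by (simp add: dominating_set_def dominates_on_def arcs_ends_def arc_to_ends_def)

section \<open>Reconfiguration sequences under a predicate on vertex sets\<close>

text \<open>\<open>P\<close> carries domination and a real-valued size bound together, which
  postpones rounding. It constrains only the ends of actual steps, so the empty sequence is always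
  allowed.\<close>

definition reconf_step :: "('a set \<Rightarrow> bool) \<Rightarrow> 'a set \<Rightarrow> 'a set \<Rightarrow> bool" where
  "reconf_step P X Y \<longleftrightarrow> P X \<and> P Y \<and> adjacent_sets X Y"

abbreviation reconf :: "('a set \<Rightarrow> bool) \<Rightarrow> 'a set \<Rightarrow> 'a set \<Rightarrow> bool" where
  "reconf P \<equiv> (reconf_step P)\<^sup>*\<^sup>*"

lemma reconf_sym: "reconf P X Y \<Longrightarrow> reconf P Y X"
proof (rule sympD[OF symp_rtranclp])
  show "symp (reconf_step P)"
    by (rule sympI) (auto simp: reconf_step_def adjacent_sets_def)
qed

text \<open>A set \<open>W\<close> disjoint from every set of the sequence leaves all symmetric
  differences unchanged, so it can be carried along frozen.\<close>

lemma reconf_Un: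
  assumes "reconf P X Y"
    and "\<And>Z. P Z \<Longrightarrow> Z \<inter> W = {} \<and> Q (Z \<union> W)"
  shows "reconf Q (X \<union> W) (Y \<union> W)"
  using assms(1)
proof induction
  case (step Y Z)
  have YZ: "P Y" "P Z" "adjacent_sets Y Z"
    using step.hyps(2) by (auto simp: reconf_step_def)
  then have "(Y \<union> W) - (Z \<union> W) = Y - Z" "(Z \<union> W) - (Y \<union> W) = Z - Y"
    using assms(2)[of Y] assms(2)[of Z] by auto
  then have "reconf_step Q (Y \<union> W) (Z \<union> W)"
    using YZ assms(2)[of Y] assms(2)[of Z] by (simp add: reconf_step_def adjacent_sets_def)
  then show ?case
    using step.IH by (rule rtranclp.rtrancl_into_rtrancl[rotated])
qed simp

lemma reconf_mono: "reconf P X Y \<Longrightarrow> (\<And>Z. P Z \<Longrightarrow> Q Z) \<Longrightarrow> reconf Q X Y"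
  using reconf_Un[of P X Y "{}" Q] by simp

lemma reconf_add:
  assumes "finite S" and "\<And>Z. X \<subseteq> Z \<Longrightarrow> Z \<subseteq> X \<union> S \<Longrightarrow> P Z"
  shows "reconf P X (X \<union> S)"
  using assms
proof (induction S)
  case (insert s S)
  have IH: "reconf P X (X \<union> S)"
    by (rule insert.IH) (use insert.prems in blast)
  show ?case
  proof (cases "s \<in> X")
    case True
    then have "X \<union> insert s S = X \<union> S" by auto
    then show ?thesis using IH by simp
  next
    case False
    then have "(X \<union> S) - (X \<union> insert s S) = {}" "(X \<union> insert s S) - (X \<union> S) = {s}"
      using insert.hyps by auto
    then have "adjacent_sets (X \<union> S) (X \<union> insert s S)"
      unfolding adjacent_sets_def by simp
    moreover have "P (X \<union> S)" "P (X \<union> insert s S)"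
      by (rule insert.prems; blast)+
    ultimately have "reconf_step P (X \<union> S) (X \<union> insert s S)"
      by (simp add: reconf_step_def)
    with IH show ?thesis by (rule rtranclp.rtrancl_into_rtrancl)
  qed
qed simp

text \<open>\<open>P D\<close> is a separate hypothesis because a sequence of length 0 does not
  provide it.\<close>

lemma reconf_imp_transforms:
  assumes "reconf P D D'" and "P D"
    and P: "\<And>Z. P Z \<Longrightarrow> dominating_set G Z \<and> card Z \<le> k"
  shows "transforms G k D D'"
proof -
  from assms(1) obtain l where "(reconf_step P ^^ l) D D'"
    by (auto simp: rtranclp_power)
  then obtain f where f: "f 0 = D" "f l = D'" "\<And>i. i < l \<Longrightarrow> reconf_step P (f i) (f (Suc i))"
    by (auto simp: relpowp_fun_conv)
  have "P (f i)" if "i \<le> l" for i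
    using that f \<open>P D\<close> by (cases i) (auto simp: reconf_step_def Suc_le_eq)
  moreover have "adjacent_sets (f (i - 1)) (f i)" if "i \<in> {1..l}" for i
    using f(3)[of "i - 1"] that by (auto simp: reconf_step_def)
  ultimately show ?thesis
    unfolding transforms_def using f P by blast
qed

section \<open>Passing between a graph and its induced subgraphs\<close>

definition induced :: "'a pair_pre_digraph \<Rightarrow> 'a set \<Rightarrow> 'a pair_pre_digraph" where
  "induced G A = \<lparr>pverts = A, parcs = {e \<in> parcs G. fst e \<in> A \<and> snd e \<in> A}\<rparr>"

lemma induced_simps [simp]:
  "pverts (induced G A) = A" "parcs (induced G A) = {e \<in> parcs G. fst e \<in> A \<and> snd e \<in> A}"
  by (simp_all add: induced_def)

lemma induced_subgraph_induced:
  assumes "pair_graph G" "A \<subseteq> pverts G"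
  shows "induced_subgraph (with_proj (induced G A)) (with_proj G)"
proof -
  interpret pair_graph G by fact
  show ?thesis
    unfolding induced_subgraph_def subgraph_def
    using assms(2) wf_digraph by (auto simp: compatible_def wf_digraph_def)
qed

lemma dominates_on_induced:
  assumes "dominates_on (parcs G) D T" and "T \<subseteq> A"
    and "\<And>v u. v \<in> T \<Longrightarrow> u \<in> D \<Longrightarrow> (v, u) \<in> parcs G \<Longrightarrow> u \<in> A"
  shows "dominates_on (parcs (induced G A)) (D \<inter> A) T"
  using assms unfolding dominates_on_def by fastforce

lemma reconf_exchange:
  assumes "finite W" and "W \<inter> A = {}" and "A \<union> W \<subseteq> V"
    and "reconf (\<lambda>Z. Z \<subseteq> A \<and> dominates_on (parcs (induced G A)) Z T' \<and> real (card Z) \<le> m) X Y"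
    and "dominates_on (parcs G) W (T - T')" and "m + card W \<le> M"
  shows "reconf (\<lambda>Z. Z \<subseteq> V \<and> dominates_on (parcs G) Z T \<and> real (card Z) \<le> M) (X \<union> W) (Y \<union> W)"
proof (rule reconf_Un[OF assms(4)], intro conjI)
  fix Z
  assume Z: "Z \<subseteq> A \<and> dominates_on (parcs (induced G A)) Z T' \<and> real (card Z) \<le> m"
  show "Z \<inter> W = {}" "Z \<union> W \<subseteq> V" using Z assms by auto
  show "dominates_on (parcs G) (Z \<union> W) T"
    using Z assms(5) unfolding dominates_on_def by fastforce
  show "real (card (Z \<union> W)) \<le> M"
    using Z assms(6) card_Un_le[of Z W] by linarith
qed

section \<open>The induction along balanced separators\<close>

lemma reconf_dominating:
  fixes \<G> :: "'a pair_pre_digraph set" and \<alpha> c C :: real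
  assumes graphs: "\<And>G. G \<in> \<G> \<Longrightarrow> pair_graph G"
    and her: "hereditary \<G>" and "0 < \<alpha>" and "0 < c"
    and sep: "\<And>G. G \<in> \<G> \<Longrightarrow> has_balanced_separator G (c * real (card (pverts G)) powr \<alpha>)"
    and C: "C = c / (1 - (2/3) powr \<alpha>)"
    and "G \<in> \<G>" "T \<subseteq> pverts G" "D \<subseteq> pverts G" "D' \<subseteq> pverts G"
    and "dominates_on (parcs G) D T" "dominates_on (parcs G) D' T"
  shows "reconf (\<lambda>X. X \<subseteq> pverts G \<and> dominates_on (parcs G) X T \<and>
      real (card X) \<le> real (max (card D) (card D')) + C * real (card (pverts G)) powr \<alpha>) D D'"
  using assms(7-)
proof (induction "card (pverts G)" arbitrary: G T D D' rule: less_induct)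
  case less
  interpret pair_graph G by (rule graphs) fact
  define n where "n = card (pverts G)"
  show ?case
  proof (cases "n = 0")
    case True
    then have "D = {}" "D' = {}"
      using less.prems by (auto simp: n_def)
    then show ?thesis by simp
  next
    case False
    have fin: "finite (pverts G)" by simp
    have q: "(2/3) powr \<alpha> < (1::real)"
      using powr_less_mono2[of \<alpha> "2/3" 1] \<open>0 < \<alpha>\<close> by simp
    then have "0 < C" and "C * (1 - (2/3) powr \<alpha>) = c"
      using \<open>0 < c\<close> by (auto simp: C)
    \<comment> \<open>\<open>C\<close> is the sum of the geometric series, that is, the fixed point
      that lets the induction close.\<close>
    then have Cq: "C * (2/3) powr \<alpha> + c = C"
      by (simp add: algebra_simps)
    obtain S A B where SAB: "S \<union> A \<union> B = pverts G" "S \<inter> A = {}" "S \<inter> B = {}" "A \<inter> B = {}"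
      and S: "real (card S) \<le> c * real n powr \<alpha>"
      and AB: "real (card A) \<le> 2 * real n / 3" "real (card B) \<le> 2 * real n / 3"
      and arcs: "\<And>a b. a \<in> A \<Longrightarrow> b \<in> B \<Longrightarrow> (a, b) \<notin> parcs G"
      using sep[OF \<open>G \<in> \<G>\<close>]
      unfolding has_balanced_separator_def
      by (auto simp: n_def arcs_ends_def arc_to_ends_def)
    have arcs': "(b, a) \<notin> parcs G" if "a \<in> A" "b \<in> B" for a b
      using arcs[OF that] arcs_symmetric by auto
    have fins: "finite S" "finite A" "finite B"
      using fin SAB(1) by (metis finite_Un)+
    \<comment> \<open>What side \<open>R\<close> must still dominate by itself once \<open>S\<close>
      is present.\<close>
    define T' where "T' R = {v \<in> T \<inter> R. \<forall>s\<in>S. (v, s) \<notin> parcs G}" for R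
    have T'_sub: "T' R \<subseteq> R" for R
      by (auto simp: T'_def)
    \<comment> \<open>The induction hypothesis on one side. The excess is stated with
      \<open>2 * real n / 3\<close> instead of \<open>card R\<close> so that it is the same for both
      sides.\<close>
    have part: "reconf (\<lambda>Z. Z \<subseteq> R \<and> dominates_on (parcs (induced G R)) Z (T' R) \<and>
        real (card Z) \<le> real (max (card (D \<inter> R)) (card (D' \<inter> R))) + C * (2 * real n / 3) powr \<alpha>)
        (D \<inter> R) (D' \<inter> R)"
      if R: "R = A \<or> R = B" and D: "D \<subseteq> pverts G" "dominates_on (parcs G) D T"
        and D': "D' \<subseteq> pverts G" "dominates_on (parcs G) D' T" for R D D'
    proof -
      have Rsub: "R \<subseteq> pverts G" and Rn: "real (card R) \<le> 2 * real n / 3"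
        using R SAB AB by auto
      have dom: "dominates_on (parcs (induced G R)) (D \<inter> R) (T' R)"
        if "D \<subseteq> pverts G" "dominates_on (parcs G) D T" for D
      proof (rule dominates_on_induced)
        show "dominates_on (parcs G) D (T' R)"
          using that(2) unfolding dominates_on_def T'_def by blast
        show "T' R \<subseteq> R" by (rule T'_sub)
        fix v u assume "v \<in> T' R" "u \<in> D" "(v, u) \<in> parcs G"
        then show "u \<in> R"
          using R that(1) SAB(1) arcs arcs' unfolding T'_def by blast
      qed
      \<comment> \<open>\<open>2 * n / 3 < n\<close> uses \<open>n \<noteq> 0\<close>; this is why
        the empty graph was split off.\<close>
      have "card R < card (pverts G)"
        using Rn False unfolding n_def by linarith
      moreover have "induced G R \<in> \<G>"
        using her induced_subgraph_induced[OF graphs Rsub] \<open>G \<in> \<G>\<close> unfolding hereditary_def by blast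
      ultimately have "reconf (\<lambda>Z. Z \<subseteq> R \<and> dominates_on (parcs (induced G R)) Z (T' R) \<and>
        real (card Z) \<le> real (max (card (D \<inter> R)) (card (D' \<inter> R))) + C * real (card R) powr \<alpha>)
        (D \<inter> R) (D' \<inter> R)"
        using less.hyps[of "induced G R" "T' R" "D \<inter> R" "D' \<inter> R"] dom[OF D] dom[OF D'] T'_sub
        by simp
      moreover have "C * real (card R) powr \<alpha> \<le> C * (2 * real n / 3) powr \<alpha>"
        using Rn \<open>0 < C\<close> \<open>0 < \<alpha>\<close> by (intro mult_left_mono powr_mono2) auto
      ultimately show ?thesis
        by (elim reconf_mono) auto
    qed
    have pow: "C * (2 * real n / 3) powr \<alpha> + c * real n powr \<alpha> = C * real n powr \<alpha>"
    proof -
      have "(2 * real n / 3) powr \<alpha> = (2/3) powr \<alpha> * real n powr \<alpha>"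
        using powr_mult[of "2/3" "real n" \<alpha>] by simp
      then show ?thesis using Cq by (metis distrib_right mult.assoc)
    qed
    have cards: "card (D \<inter> A) + card (D \<inter> B) \<le> card D" if "D \<subseteq> pverts G" for D
    proof -
      have "card (D \<inter> A) + card (D \<inter> B) = card ((D \<inter> A) \<union> (D \<inter> B))"
        using fins SAB by (subst card_Un_disjoint) auto
      also have "\<dots> \<le> card D"
        using that fin by (intro card_mono) (auto intro: finite_subset)
      finally show ?thesis .
    qed
    define Q where "Q M X \<longleftrightarrow> X \<subseteq> pverts G \<and> dominates_on (parcs G) X T \<and>
      real (card X) \<le> real M + C * real n powr \<alpha>" for M :: nat and X
    have SC: "real (card S) \<le> C * real n powr \<alpha>"
      using S pow \<open>0 < C\<close> by (smt (verit) mult_nonneg_nonneg powr_ge_zero)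
    have sepadd: "reconf (Q M) D (D \<union> S)"
      if D: "D \<subseteq> pverts G" "dominates_on (parcs G) D T" and "card D \<le> M" for D M
    proof (rule reconf_add[OF fins(1)])
      fix Z assume Z: "D \<subseteq> Z" "Z \<subseteq> D \<union> S"
      have "finite (D \<union> S)" using D fin fins by (auto intro: finite_subset)
      then have "card Z \<le> card D + card S"
        using card_mono[OF _ Z(2)] card_Un_le[of D S] by linarith
      then show "Q M Z"
        using D Z SAB(1) SC \<open>card D \<le> M\<close> dominates_on_mono[OF D(2) Z(1)] unfolding Q_def by auto
    qed
    \<comment> \<open>\<open>mid\<close> bounds the set halfway, with \<open>S\<close> left out,
      when \<open>A\<close> is exchanged first. \<open>D\<close>, \<open>D'\<close> and
      \<open>M\<close> are generalised so that the roles of \<open>D\<close> and \<open>D'\<close>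
      can be swapped below.\<close>
    have main: "reconf (Q M) D D'"
      if D: "D \<subseteq> pverts G" "dominates_on (parcs G) D T"
        and D': "D' \<subseteq> pverts G" "dominates_on (parcs G) D' T"
        and M: "card D \<le> M" "card D' \<le> M"
        and mid: "card (D' \<inter> A) + card (D \<inter> B) \<le> M" for D D' M
    proof -
      define m where "m R = real (max (card (D \<inter> R)) (card (D' \<inter> R))) + C * (2 * real n / 3) powr \<alpha>" for R
      \<comment> \<open>While \<open>R\<close> is exchanged, \<open>S\<close> and the trace of
        \<open>E\<close> on the other side \<open>R'\<close> stay frozen; \<open>E\<close> is
        \<open>D\<close> for the first exchange and \<open>D'\<close> for the second.\<close>
      have exch: "reconf (Q M) ((D \<inter> R) \<union> W) ((D' \<inter> R) \<union> W)"
        if R: "R = A \<and> R' = B \<or> R = B \<and> R' = A"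
          and W: "E = D \<or> E = D'" "W = S \<union> (E \<inter> R')"
          and le: "max (card (D \<inter> R)) (card (D' \<inter> R)) + card (E \<inter> R') \<le> M" for R R' W E
        unfolding Q_def
      proof (rule reconf_exchange[where T' = "T' R" and m = "m R"])
        show "finite W" "W \<inter> R = {}" "R \<union> W \<subseteq> pverts G"
          using R W fins SAB by auto
        show "reconf (\<lambda>Z. Z \<subseteq> R \<and> dominates_on (parcs (induced G R)) Z (T' R) \<and> real (card Z) \<le> m R)
            (D \<inter> R) (D' \<inter> R)"
          unfolding m_def using R by (intro part D D') auto
        have E: "dominates_on (parcs G) E T" "E \<subseteq> pverts G" using W D D' by auto
        show "dominates_on (parcs G) W (T - T' R)"
          unfolding dominates_on_def
        proof
          fix v assume v: "v \<in> T - T' R"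
          then have "v \<in> pverts G" using less.prems by auto
          \<comment> \<open>A vertex of \<open>S\<close> lies in \<open>W\<close>; one of
            \<open>R\<close> outside \<open>T' R\<close> has a neighbour in \<open>S\<close>; one of
            \<open>R'\<close> has no neighbour in \<open>R\<close>, so whatever dominates it in
            \<open>E\<close> survives in \<open>W\<close>.\<close>
          then consider "v \<in> S" | "v \<in> R" | "v \<in> R'" using SAB(1) R by blast
          then show "v \<in> W \<or> (\<exists>u\<in>W. (v, u) \<in> parcs G)"
          proof cases
            case 2 then show ?thesis using v W by (auto simp: T'_def)
          next
            case 3
            then have "(v, u) \<notin> parcs G" if "u \<in> R" for u
              using R arcs arcs' that by blast
            then show ?thesis
              using 3 v E SAB(1) R W unfolding dominates_on_def by blast
          qed (use W in auto)
        qed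
        have "card W \<le> card S + card (E \<inter> R')"
          unfolding W(2) by (rule card_Un_le)
        then show "m R + card W \<le> real M + C * real n powr \<alpha>"
          using S pow le unfolding m_def by linarith
      qed
      \<comment> \<open>Of the two sizes in the maximum, \<open>cards\<close> bounds the initial one
        and \<open>mid\<close> the one after the exchange.\<close>
      have "reconf (Q M) ((D \<inter> A) \<union> (S \<union> (D \<inter> B))) ((D' \<inter> A) \<union> (S \<union> (D \<inter> B)))"
        using cards[OF D(1)] M mid by (intro exch[where R' = B and E = D]) auto
      moreover have "reconf (Q M) ((D \<inter> B) \<union> (S \<union> (D' \<inter> A))) ((D' \<inter> B) \<union> (S \<union> (D' \<inter> A)))"
        using cards[OF D'(1)] M mid by (intro exch[where R' = A and E = D']) auto
      moreover have "(D \<inter> A) \<union> (S \<union> (D \<inter> B)) = D \<union> S" "(D' \<inter> B) \<union> (S \<union> (D' \<inter> A)) = D' \<union> S"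
        "(D' \<inter> A) \<union> (S \<union> (D \<inter> B)) = (D \<inter> B) \<union> (S \<union> (D' \<inter> A))"
        using D(1) D'(1) SAB(1) by blast+
      ultimately have "reconf (Q M) (D \<union> S) (D' \<union> S)"
        by (metis rtranclp_trans)
      then show ?thesis
        using sepadd[OF D M(1)] reconf_sym[OF sepadd[OF D' M(2)]] by (meson rtranclp_trans)
    qed
    let ?M = "max (card D) (card D')"
    note prems = less.prems(3,5) less.prems(4,6)
    have "reconf (Q ?M) D D'"
    proof (cases "card (D' \<inter> A) + card (D \<inter> B) \<le> ?M")
      case True
      then show ?thesis by (intro main prems) auto
    next
      case False
      then have "card (D \<inter> A) + card (D' \<inter> B) \<le> ?M"
        using cards[OF prems(1)] cards[OF prems(3)] by linarith
      \<comment> \<open>Reversing a sequence from \<open>D'\<close> to \<open>D\<close> that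
        exchanges \<open>A\<close> first gives one from \<open>D\<close> to \<open>D'\<close> that
        exchanges \<open>B\<close> first.\<close>
      then show ?thesis by (intro reconf_sym[OF main] prems) auto
    qed
    then show ?thesis
      unfolding Q_def n_def .
  qed
qed

section \<open>Rounding the real bound to an admissible \<open>k\<close>\<close>

theorem theorem2:
  fixes \<G> :: "'a pair_pre_digraph set" and \<alpha> :: real
  assumes "\<And>G. G \<in> \<G> \<Longrightarrow> pair_graph G"
    and "hereditary \<G>"
    and "0 < \<alpha>" and "\<alpha> < 1"
    and "class_has_balanced_separators \<G> (\<lambda>n. real n powr \<alpha>)"
  shows "\<exists>C>0. \<forall>G\<in>\<G>. pverts G \<noteq> {} \<longrightarrow>
           (\<forall>D D'. dominating_set G D \<and> dominating_set G D' \<longrightarrow>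
              real_of_int (dom_gap G D D') \<le> C * real (card (pverts G)) powr \<alpha>)"
proof -
  from assms(5) obtain c where c: "c > 0"
    "\<And>G. G \<in> \<G> \<Longrightarrow> has_balanced_separator G (c * real (card (pverts G)) powr \<alpha>)"
    unfolding class_has_balanced_separators_def by blast
  define C where "C = c / (1 - (2/3) powr \<alpha>)"
  have "(2/3) powr \<alpha> < (1::real)"
    using powr_less_mono2[of \<alpha> "2/3" 1] assms(3) by simp
  then have "C > 0" using c(1) by (simp add: C_def)
  show ?thesis
  proof (intro exI[of _ C] conjI ballI impI allI \<open>C > 0\<close>)
    fix G D D'
    assume G: "G \<in> \<G>" "pverts G \<noteq> {}" and "dominating_set G D \<and> dominating_set G D'"
    then have D: "D \<subseteq> pverts G" "dominates_on (parcs G) D (pverts G)"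
      and D': "D' \<subseteq> pverts G" "dominates_on (parcs G) D' (pverts G)"
      by (auto simp: dominating_set_iff)
    interpret pair_graph G using assms(1) G by blast
    let ?M = "max (card D) (card D')" and ?e = "C * real (card (pverts G)) powr \<alpha>"
    define k where "k = nat \<lfloor>real ?M + ?e\<rfloor>"
    have "0 \<le> ?e" using \<open>C > 0\<close> by simp
    have le_k: "m \<le> k \<longleftrightarrow> real m \<le> real ?M + ?e" for m :: nat
      unfolding k_def using \<open>0 \<le> ?e\<close> by (simp add: le_nat_iff) linarith
    \<comment> \<open>The minimum in \<open>dom_gap\<close> ranges over positive \<open>k\<close>;
      positivity comes from a dominating set of a nonempty graph being nonempty.\<close>
    have "D \<noteq> {}" using D(2) G(2) by (auto simp: dominates_on_def)
    then have "card D > 0" using D(1) by (simp add: card_gt_0_iff finite_subset)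
    moreover have "card D \<le> k" using \<open>0 \<le> ?e\<close> by (simp add: le_k)
    ultimately have "k > 0" by linarith
    moreover have "transforms G k D D'"
    proof (rule reconf_imp_transforms)
      show "reconf (\<lambda>X. X \<subseteq> pverts G \<and> dominates_on (parcs G) X (pverts G) \<and> real (card X) \<le> real ?M + ?e) D D'"
        by (rule reconf_dominating[OF assms(1-3) c C_def G(1) subset_refl D(1) D'(1) D(2) D'(2)])
    qed (use D \<open>card D \<le> k\<close> in \<open>auto simp: dominating_set_iff le_k\<close>)
    ultimately have "(LEAST k. k > 0 \<and> transforms G k D D') \<le> k"
      by (intro Least_le conjI)
    then show "real_of_int (dom_gap G D D') \<le> ?e"
      unfolding dom_gap_def le_k by simp
  qed
qed

end
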